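(* Let $d\ge1$ and let $\Delta_d\subset\mathbb{R}^d$ be a perfectly centered simplex of dimension $d$, with dual $\Delta_d^*$. Then for $0\le k\le d-1$, $$f_k(\Delta_d+\Delta_d^* )=\binom{d+1}{k+2}\left(2^{k+2}-2\right).$$
   Context: $f_k(Q)$ is the number of $k$-dimensional faces of a polytope $Q$; $+$ denotes Minkowski sum; the dual of a polytope $P\subset\mathbb{R}^d$ containing the origin in its interior is $P^*=\{x:\langle x,y\rangle\le1\ \forall y\in P\}$. For a nonempty face $F$ of $P$, the outer normal cone $\mathcal{N}(F;P)$ is the set of $c\in\mathbb{R}^d$ such that $F$ is exactly the set of maximizers of $\langle\cdot,c\rangle$ over $P$. A full-dimensional polytope $P\subset\mathbb{R}^d$ is perfectly centered if $\mathrm{relint}(F)\cap\mathcal{N}(F;P)\neq\emptyset$ for every nonempty face $F$ of $P$ (including $F=P$, where $\mathcal{N}(P;P)=\{0\}$, so the origin is in the interior of $P$). *)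

theory Defs
  imports "HOL-Analysis.Analysis"
begin

text \<open>
  For polytopes, the nonempty sets \<open>F\<close> with \<open>F face_of P\<close> are precisely the sets of maximizers of
  linear functionals over \<open>P\<close>; both \<open>P\<close> itself and the empty set count as faces.  The empty face
  has \<open>aff_dim\<close> equal to \<open>-1\<close>, so it is not counted by \<open>num_faces k\<close> for a natural number \<open>k\<close>.
\<close>

definition num_faces :: "nat \<Rightarrow> 'a::euclidean_space set \<Rightarrow> nat" where
  "num_faces k Q = card {F. F face_of Q \<and> aff_dim F = int k}"

definition dual_polytope :: "'a::euclidean_space set \<Rightarrow> 'a set" where
  "dual_polytope P = {x. \<forall>y\<in>P. x \<bullet> y \<le> 1}"

text \<open>
  The set of maximizers is required to be exactly \<open>F\<close>, so for a nonempty face this is the relatively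
  open normal cone.
\<close>

definition outer_normal_cone :: "'a::euclidean_space set \<Rightarrow> 'a set \<Rightarrow> 'a set" where
  "outer_normal_cone F P = {c. F = {x \<in> P. \<forall>y\<in>P. y \<bullet> c \<le> x \<bullet> c}}"

definition perfectly_centered :: "'a::euclidean_space set \<Rightarrow> bool" where
  "perfectly_centered P \<longleftrightarrow>
     polytope P \<and> aff_dim P = int DIM('a) \<and>
     (\<forall>F. F face_of P \<and> F \<noteq> {} \<longrightarrow> rel_interior F \<inter> outer_normal_cone F P \<noteq> {})"

end

theory Submission
  imports Defs
begin

text \<open>
  Let \<open>V\<close> be the vertex set of the simplex.  The maximizers of a functional \<open>c\<close> over a Minkowski sum
  are the sum of the maximizers over the summands, so the nonempty faces of the sum are the
  sets \<open>F + G\<close> with \<open>F\<close> and \<open>G\<close> maximizing a common \<open>c\<close>.  Over the simplex, the maximizers are the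
  hull of some \<open>S \<subseteq> V\<close>; over the dual they are the points \<open>x\<close> with
  \<open>x \<bullet> v = 1\<close> for all \<open>v \<in> R\<close> when \<open>c\<close> is a positive combination of the proper subset \<open>R\<close> of \<open>V\<close>.  Perfect centering says exactly which pairs
  \<open>(S, R)\<close> share a functional, namely those with \<open>S \<subseteq> R\<close>: every \<open>c\<close> in the cone of \<open>R\<close> decomposes
  along a flag of centers of faces of \<open>R\<close>, and conversely the sum of the centers of \<open>S\<close> and \<open>R\<close> works.
  The summands are then orthogonal, the sum has dimension \<open>|S| + |V - R| - 2\<close>, and it
  remains to count pairs of disjoint nonempty subsets of \<open>V\<close> with \<open>k + 2\<close> elements in total.
\<close>

section \<open>Maximizers of linear functionals\<close>

definition maximizers :: "'a::real_inner set \<Rightarrow> 'a \<Rightarrow> 'a set" where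
  "maximizers P c = {x \<in> P. \<forall>y\<in>P. y \<bullet> c \<le> x \<bullet> c}"

lemma maximizers_subset: "maximizers P c \<subseteq> P"
  by (auto simp: maximizers_def)

lemma outer_normal_cone_iff: "c \<in> outer_normal_cone F P \<longleftrightarrow> F = maximizers P c"
  by (simp add: outer_normal_cone_def maximizers_def)

lemma maximizers_less:
  assumes "x \<in> maximizers P c" "y \<in> P" "y \<notin> maximizers P c"
  shows "y \<bullet> c < x \<bullet> c"
proof -
  obtain z where "z \<in> P" "y \<bullet> c < z \<bullet> c"
    using assms(2,3) by (auto simp: maximizers_def not_le)
  moreover have "z \<bullet> c \<le> x \<bullet> c"
    using assms(1) \<open>z \<in> P\<close> by (simp add: maximizers_def)
  ultimately show ?thesis by simp
qed

lemma maximizers_nonempty: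
  assumes "finite V" "V \<noteq> {}"
  shows "maximizers V c \<noteq> {}"
proof -
  have "Max ((\<lambda>v. v \<bullet> c) ` V) \<in> (\<lambda>v. v \<bullet> c) ` V"
    using assms by (intro Max_in) auto
  then obtain v where "v \<in> V" "v \<bullet> c = Max ((\<lambda>v. v \<bullet> c) ` V)"
    by auto
  then have "v \<in> maximizers V c"
    using assms by (simp add: maximizers_def)
  then show ?thesis by blast
qed

text \<open>A common maximizer attains both maxima at once, so a point maximizing the sum cannot
  lose in either functional.\<close>

lemma maximizers_functional_add:
  assumes "maximizers P c \<inter> maximizers P c' \<noteq> {}"
  shows "maximizers P (c + c') = maximizers P c \<inter> maximizers P c'"
proof -
  obtain x where x: "x \<in> P" "\<And>y. y \<in> P \<Longrightarrow> y \<bullet> c \<le> x \<bullet> c" "\<And>y. y \<in> P \<Longrightarrow> y \<bullet> c' \<le> x \<bullet> c'"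
    using assms by (auto simp: maximizers_def)
  have eq: "z \<bullet> c = x \<bullet> c \<and> z \<bullet> c' = x \<bullet> c'" if "z \<in> P" "x \<bullet> (c + c') \<le> z \<bullet> (c + c')" for z
    using x(2)[OF that(1)] x(3)[OF that(1)] that(2) by (simp add: inner_add_right)
  show ?thesis
  proof
    show "maximizers P (c + c') \<subseteq> maximizers P c \<inter> maximizers P c'"
    proof
      fix z assume "z \<in> maximizers P (c + c')"
      then have "z \<in> P" "x \<bullet> (c + c') \<le> z \<bullet> (c + c')"
        using x(1) by (auto simp: maximizers_def)
      moreover from eq[OF this] have "z \<bullet> c = x \<bullet> c" "z \<bullet> c' = x \<bullet> c'"
        by simp_all
      ultimately show "z \<in> maximizers P c \<inter> maximizers P c'"
        using x(2,3) by (simp add: maximizers_def)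
    qed
    show "maximizers P c \<inter> maximizers P c' \<subseteq> maximizers P (c + c')"
      by (auto simp: maximizers_def inner_add_right intro!: add_mono)
  qed
qed

text \<open>The two summands vary independently: fixing one of them in a maximal sum shows that the
  other is maximal.\<close>

lemma maximizers_set_plus:
  assumes "maximizers P c \<noteq> {}" "maximizers Q c \<noteq> {}"
  shows "maximizers (P + Q) c = maximizers P c + maximizers Q c"
proof
  show "maximizers P c + maximizers Q c \<subseteq> maximizers (P + Q) c"
  proof
    fix z assume "z \<in> maximizers P c + maximizers Q c"
    then obtain x y where z: "z = x + y" and x: "x \<in> maximizers P c" and y: "y \<in> maximizers Q c"
      by (rule set_plus_elim)
    have "w \<bullet> c \<le> z \<bullet> c" if "w \<in> P + Q" for w
    proof -
      from that obtain x' y' where w: "w = x' + y'" "x' \<in> P" "y' \<in> Q"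
        by (rule set_plus_elim)
      then have "x' \<bullet> c \<le> x \<bullet> c" "y' \<bullet> c \<le> y \<bullet> c"
        using x y by (auto simp: maximizers_def)
      then show ?thesis
        by (simp add: z w(1) inner_add_left)
    qed
    moreover have "z \<in> P + Q"
      using x y z by (auto simp: maximizers_def)
    ultimately show "z \<in> maximizers (P + Q) c"
      by (simp add: maximizers_def)
  qed
  show "maximizers (P + Q) c \<subseteq> maximizers P c + maximizers Q c"
  proof
    fix z assume z: "z \<in> maximizers (P + Q) c"
    then have "z \<in> P + Q"
      by (simp add: maximizers_def)
    then obtain x y where xy: "z = x + y" "x \<in> P" "y \<in> Q"
      by (rule set_plus_elim)
    have le: "(x' + y') \<bullet> c \<le> (x + y) \<bullet> c" if "x' \<in> P" "y' \<in> Q" for x' y'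
      using z xy(1) set_plus_intro[OF that] by (simp add: maximizers_def)
    have "x \<in> maximizers P c"
      using le[OF _ xy(3)] xy(2) by (simp add: maximizers_def inner_add_left)
    moreover have "y \<in> maximizers Q c"
      using le[OF xy(2)] xy(3) by (simp add: maximizers_def inner_add_left)
    ultimately show "z \<in> maximizers P c + maximizers Q c"
      using xy(1) by blast
  qed
qed

text \<open>If \<open>x + y\<close> maximizes \<open>c'\<close> over \<open>P + Q\<close>, then
  \<open>x\<close> and \<open>y\<close> each maximize \<open>c'\<close>. A face of a sum therefore
  determines its two summands, whichever functional exposes it.\<close>

lemma maximizers_set_plus_inject_aux:
  assumes eq: "maximizers P c + maximizers Q c = maximizers P c' + maximizers Q c'"
    and ne: "maximizers P c \<noteq> {}" "maximizers Q c \<noteq> {}" "maximizers P c' \<noteq> {}" "maximizers Q c' \<noteq> {}"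
  shows "maximizers P c \<subseteq> maximizers P c' \<and> maximizers Q c \<subseteq> maximizers Q c'"
proof -
  have both: "x \<in> maximizers P c' \<and> y \<in> maximizers Q c'"
    if x: "x \<in> maximizers P c" and y: "y \<in> maximizers Q c" for x y
  proof -
    have "x + y \<in> maximizers P c' + maximizers Q c'"
      using x y eq by blast
    then have max: "x + y \<in> maximizers (P + Q) c'"
      using maximizers_set_plus ne(3,4) by blast
    have xy: "x \<in> P" "y \<in> Q"
      using x y by (auto simp: maximizers_def)
    have le: "(x' + y') \<bullet> c' \<le> (x + y) \<bullet> c'" if "x' \<in> P" "y' \<in> Q" for x' y'
      using max set_plus_intro[OF that] by (simp add: maximizers_def)
    show ?thesis
      using le[OF _ xy(2)] le[OF xy(1)] xy by (simp add: maximizers_def inner_add_left)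
  qed
  then show ?thesis
    using ne(1,2) by blast
qed

lemma maximizers_set_plus_inject:
  assumes "maximizers P c + maximizers Q c = maximizers P c' + maximizers Q c'"
    and "maximizers P c \<noteq> {}" "maximizers Q c \<noteq> {}" "maximizers P c' \<noteq> {}" "maximizers Q c' \<noteq> {}"
  shows "maximizers P c = maximizers P c'" "maximizers Q c = maximizers Q c'"
  using maximizers_set_plus_inject_aux[OF assms]
    maximizers_set_plus_inject_aux[OF assms(1)[symmetric] assms(4,5,2,3)] by auto

lemma maximizers_face_of:
  assumes "convex P"
  shows "maximizers P c face_of P"
proof (cases "maximizers P c = {}")
  case False
  then obtain x where x: "x \<in> P" "\<And>y. y \<in> P \<Longrightarrow> y \<bullet> c \<le> x \<bullet> c"
    by (auto simp: maximizers_def)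
  have "maximizers P c = P \<inter> {y. c \<bullet> y = x \<bullet> c}"
    using x by (auto simp: maximizers_def inner_commute[of c] intro: antisym)
  then show ?thesis
    using face_of_Int_supporting_hyperplane_le[OF assms, of c "x \<bullet> c"] x
    by (simp add: inner_commute[of c])
qed simp

lemma face_of_polyhedron_eq_maximizers:
  fixes P :: "'a::euclidean_space set"
  assumes "polyhedron P" "F face_of P" "F \<noteq> {}"
  obtains c where "F = maximizers P c"
proof -
  have "F exposed_face_of P"
    using assms by (simp add: exposed_face_of_polyhedron)
  then obtain a b where ab: "P \<subseteq> {x. a \<bullet> x \<le> b}" "F = P \<inter> {x. a \<bullet> x = b}"
    by (auto simp: exposed_face_of_def)
  obtain x where x: "x \<in> P" "a \<bullet> x = b"
    using ab assms(3) by auto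
  have "F = maximizers P a"
    using ab x by (auto simp: maximizers_def inner_commute[of _ a] intro: antisym)
  then show ?thesis by (rule that)
qed

lemma convex_hull_inner_le:
  assumes "\<forall>v\<in>V. v \<bullet> c \<le> m" "y \<in> convex hull V"
  shows "y \<bullet> c \<le> m"
proof -
  have "convex hull V \<subseteq> {y. c \<bullet> y \<le> m}"
    using assms(1) by (intro hull_minimal convex_halfspace_le) (auto simp: inner_commute)
  then show ?thesis
    using assms(2) by (auto simp: inner_commute)
qed

text \<open>The maximizers form a face, and a face of a hull is the hull of some \<open>U\<close>
  contained in \<open>V\<close>. Points of \<open>V\<close> maximize over the hull exactly when they
  maximize over \<open>V\<close>, so \<open>U\<close> and \<open>maximizers V c\<close> have the
  same hull.\<close>

lemma maximizers_convex_hull: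
  fixes V :: "'a::euclidean_space set"
  assumes "finite V"
  shows "maximizers (convex hull V) c = convex hull (maximizers V c)"
proof -
  obtain U where U: "U \<subseteq> V" "maximizers (convex hull V) c = convex hull U"
    by (rule face_of_convex_hull_subset[OF finite_imp_compact[OF assms]
          maximizers_face_of[OF convex_convex_hull]])
  have max: "v \<in> maximizers (convex hull V) c \<longleftrightarrow> v \<in> maximizers V c" if "v \<in> V" for v
    using that hull_inc[of _ V] convex_hull_inner_le[of V c "v \<bullet> c"]
    by (auto simp: maximizers_def)
  have "convex hull U \<subseteq> convex hull (maximizers V c)"
  proof (rule hull_mono, rule subsetI)
    fix u assume "u \<in> U"
    then have "u \<in> convex hull U" "u \<in> V"
      using U(1) by (auto simp: hull_inc)
    then show "u \<in> maximizers V c"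
      using U(2) max by simp
  qed
  moreover have "convex hull (maximizers V c) \<subseteq> convex hull U"
  proof (rule hull_minimal)
    show "maximizers V c \<subseteq> convex hull U"
      using U(2) max maximizers_subset[of V c] by blast
  qed simp
  ultimately show ?thesis
    using U(2) by blast
qed

section \<open>Dimension of orthogonal Minkowski sums\<close>

text \<open>After moving \<open>a\<close>, \<open>b\<close> and \<open>a + b\<close> to the origin,
  the translated sum lies between the union of the translated summands and the span of that union,
  and dimensions of orthogonal sets add.\<close>

lemma aff_dim_set_plus_orthogonal:
  fixes A B :: "'a::euclidean_space set"
  assumes a: "a \<in> A" and b: "b \<in> B"
    and orth: "\<And>x y. x \<in> A \<Longrightarrow> y \<in> B \<Longrightarrow> (x - a) \<bullet> (y - b) = 0"
  shows "aff_dim (A + B) = aff_dim A + aff_dim B"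
proof -
  define A' where "A' = (\<lambda>x. x - a) ` A"
  define B' where "B' = (\<lambda>x. x - b) ` B"
  define C where "C = (\<lambda>x. x - (a + b)) ` (A + B)"
  have sub1: "A' \<union> B' \<subseteq> C"
  proof -
    have "x - a = x + b - (a + b)" "y - b = a + y - (a + b)" for x y
      by simp_all
    then show ?thesis
      unfolding A'_def B'_def C_def using a b by blast
  qed
  have sub2: "C \<subseteq> span (A' \<union> B')"
  proof
    fix z assume "z \<in> C"
    then obtain x y where xy: "x \<in> A" "y \<in> B" "z = x + y - (a + b)"
      unfolding C_def by (auto elim!: set_plus_elim)
    then have "z = (x - a) + (y - b)" "x - a \<in> A'" "y - b \<in> B'"
      by (auto simp: A'_def B'_def)
    then show "z \<in> span (A' \<union> B')"
      by (simp add: span_add span_base)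
  qed
  have "dim C = dim (A' \<union> B')"
    using dim_subset[OF sub1] dim_subset[OF sub2] by simp
  also have "\<dots> = dim A' + dim B'"
    by (rule dim_orthogonal_sum) (auto simp: A'_def B'_def orth)
  finally have "dim C = dim A' + dim B'" .
  moreover have "aff_dim A = int (dim A')" "aff_dim B = int (dim B')"
    unfolding A'_def B'_def using a b by (simp_all add: aff_dim_eq_dim_subtract hull_inc)
  moreover have "aff_dim (A + B) = int (dim C)"
    unfolding C_def using a b by (intro aff_dim_eq_dim_subtract hull_inc set_plus_intro)
  ultimately show ?thesis by simp
qed

section \<open>Counting pairs of disjoint nonempty subsets\<close>

text \<open>\<open>T\<close> is the complement of the set \<open>R\<close> of the overview: the
  inclusion of \<open>S\<close> in \<open>R\<close> becomes disjointness, and properness of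
  \<open>R\<close> becomes nonemptiness of \<open>T\<close>.\<close>

definition split_pairs :: "'a set \<Rightarrow> nat \<Rightarrow> ('a set \<times> 'a set) set" where
  "split_pairs V m =
    {(S, T). S \<subseteq> V \<and> T \<subseteq> V \<and> S \<inter> T = {} \<and> S \<noteq> {} \<and> T \<noteq> {} \<and> card S + card T = m}"

text \<open>Choose the union \<open>U\<close> of the pair first, then \<open>S\<close> as a nonempty
  proper subset of \<open>U\<close>.\<close>

lemma card_split_pairs:
  assumes "finite V" "m \<noteq> 0"
  shows "card (split_pairs V m) = (card V choose m) * (2 ^ m - 2)"
proof -
  define W where "W = (SIGMA U:{U. U \<subseteq> V \<and> card U = m}. Pow U - {{}, U})"
  have "bij_betw (\<lambda>(U, S). (S, U - S)) W (split_pairs V m)"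
  proof (rule bij_betwI[where g = "\<lambda>(S, T). (S \<union> T, S)"])
    show "(\<lambda>(U, S). (S, U - S)) \<in> W \<rightarrow> split_pairs V m"
    proof (clarify intro!: funcsetI)
      fix U S assume "(U, S) \<in> W"
      then have *: "U \<subseteq> V" "card U = m" "S \<subseteq> U" "S \<noteq> {}" "S \<noteq> U"
        by (auto simp: W_def)
      then have "finite U"
        using assms finite_subset by blast
      then have "card S + card (U - S) = m"
        using * card_mono[of U S] by (simp add: card_Diff_subset finite_subset)
      then show "(S, U - S) \<in> split_pairs V m"
        using * by (auto simp: split_pairs_def)
    qed
    show "(\<lambda>(S, T). (S \<union> T, S)) \<in> split_pairs V m \<rightarrow> W"
    proof (clarify intro!: funcsetI)
      fix S T assume "(S, T) \<in> split_pairs V m"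
      then have *: "S \<subseteq> V" "T \<subseteq> V" "S \<inter> T = {}" "S \<noteq> {}" "T \<noteq> {}" "card S + card T = m"
        by (auto simp: split_pairs_def)
      then have "card (S \<union> T) = m"
        using card_Un_disjoint[of S T] finite_subset[OF _ assms(1)] by simp
      then show "(S \<union> T, S) \<in> W"
        using * by (auto simp: W_def)
    qed
  qed (auto simp: W_def split_pairs_def)
  then have "card (split_pairs V m) = card W"
    by (simp add: bij_betw_same_card)
  also have "\<dots> = (\<Sum>U | U \<subseteq> V \<and> card U = m. card (Pow U - {{}, U}))"
    unfolding W_def using finite_subset[OF _ assms(1)] assms(1) by (intro card_SigmaI) auto
  also have "\<dots> = (\<Sum>U | U \<subseteq> V \<and> card U = m. 2 ^ m - 2)"
  proof (rule sum.cong[OF refl])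
    fix U assume U: "U \<in> {U. U \<subseteq> V \<and> card U = m}"
    \<comment> \<open>Since \<open>m\<close> is nonzero, the two excluded subsets \<open>{}\<close>
      and \<open>U\<close> are distinct, so exactly 2 is subtracted.\<close>
    then have "U \<noteq> {}" "finite U"
      using assms finite_subset by auto
    then show "card (Pow U - {{}, U}) = 2 ^ m - 2"
      using U by (subst card_Diff_subset) (auto simp: card_Pow)
  qed
  also have "\<dots> = (card V choose m) * (2 ^ m - 2)"
    using n_subsets[OF assms(1), of m] by simp
  finally show ?thesis .
qed

section \<open>Perfectly centered simplices\<close>

locale centered_simplex =
  fixes V :: "'a::euclidean_space set"
  assumes aff_indep: "\<not> affine_dependent V"
    and card_V: "card V = Suc DIM('a)"
    and centered: "perfectly_centered (convex hull V)"
begin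

lemma finite_V: "finite V"
  using aff_indep by (rule aff_independent_finite)

lemma V_nonempty: "V \<noteq> {}"
  using card_V by auto

lemma aff_indep_subset: "R \<subseteq> V \<Longrightarrow> \<not> affine_dependent R"
  using aff_indep affine_independent_subset by blast

lemma mem_convex_hull_iff:
  assumes "R \<subseteq> V" "v \<in> V"
  shows "v \<in> convex hull R \<longleftrightarrow> v \<in> R"
proof
  assume v: "v \<in> convex hull R"
  show "v \<in> R"
  proof (rule ccontr)
    assume "v \<notin> R"
    then have "R \<subseteq> V - {v}"
      using assms(1) by blast
    then have "v \<in> affine hull (V - {v})"
      using v convex_hull_subset_affine_hull[of R] hull_mono[of R "V - {v}" affine] by blast
    then show False
      using aff_indep assms(2) by (auto simp: affine_dependent_def)
  qed
qed (simp add: hull_inc)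

lemma convex_hull_inject:
  assumes "R \<subseteq> V" "S \<subseteq> V" "convex hull R = convex hull S"
  shows "R = S"
proof -
  have "v \<in> R \<longleftrightarrow> v \<in> S" if "v \<in> V" for v
    using mem_convex_hull_iff[OF assms(1) that] mem_convex_hull_iff[OF assms(2) that] assms(3)
    by simp
  then show ?thesis
    using assms(1,2) by blast
qed

text \<open>Barycentric coordinates of the point supplied by perfect centering: the relative
  interior makes them positive, and the normal cone makes \<open>R\<close> the exact set of
  maximizing vertices.\<close>

lemma center:
  assumes "R \<subseteq> V" "R \<noteq> {}"
  obtains a where "\<forall>v\<in>R. 0 < a v" "sum a R = 1" "maximizers V (\<Sum>v\<in>R. a v *\<^sub>R v) = R"
proof -
  have "convex hull R face_of convex hull V" "convex hull R \<noteq> {}"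
    using assms face_of_convex_hull_affine_independent[OF aff_indep] by auto
  then have "rel_interior (convex hull R) \<inter> outer_normal_cone (convex hull R) (convex hull V) \<noteq> {}"
    using centered unfolding perfectly_centered_def by blast
  then obtain p where p: "p \<in> rel_interior (convex hull R)"
    and max: "convex hull R = maximizers (convex hull V) p"
    using outer_normal_cone_iff by blast
  from p obtain a where a: "\<forall>v\<in>R. 0 < a v" "sum a R = 1" "(\<Sum>v\<in>R. a v *\<^sub>R v) = p"
    by (auto simp: rel_interior_convex_hull_explicit[OF aff_indep_subset[OF assms(1)]])
  have "maximizers V p = R"
    using convex_hull_inject[OF assms(1) maximizers_subset] max maximizers_convex_hull[OF finite_V]
    by simp
  then show ?thesis
    using that[of a] a by simp
qed

text \<open>The center of the whole simplex is a functional constant on \<open>V\<close>, hence on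
  the affine hull of \<open>V\<close>, which is the whole space. So it is zero.\<close>

lemma zero_combination:
  obtains l where "\<forall>v\<in>V. 0 < l v" "sum l V = 1" "(\<Sum>v\<in>V. l v *\<^sub>R v) = 0"
proof -
  obtain l where l: "\<forall>v\<in>V. 0 < l v" "sum l V = 1" and max: "maximizers V (\<Sum>v\<in>V. l v *\<^sub>R v) = V"
    by (rule center[OF subset_refl V_nonempty])
  define p where "p = (\<Sum>v\<in>V. l v *\<^sub>R v)"
  obtain w where w: "w \<in> V"
    using V_nonempty by blast
  have le: "y \<bullet> p \<le> x \<bullet> p" if "x \<in> V" "y \<in> V" for x y
  proof -
    have "x \<in> maximizers V p"
      using max that(1) by (simp add: p_def)
    then show ?thesis
      using that(2) by (simp add: maximizers_def)
  qed
  have "V \<subseteq> {x. p \<bullet> x = p \<bullet> w}"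
    using le w by (auto simp: inner_commute[of p] intro!: antisym)
  then have "affine hull V \<subseteq> {x. p \<bullet> x = p \<bullet> w}"
    by (intro hull_minimal affine_hyperplane)
  then have "p \<bullet> x = p \<bullet> w" for x
    using affine_independent_span_eq[OF aff_indep card_V] by auto
  from this[of p] this[of 0] have "p = 0"
    by simp
  then show ?thesis
    unfolding p_def by (rule that[OF l])
qed

lemma zero_in_convex_hull_interior: "0 \<in> interior (convex hull V)"
proof -
  obtain l where "\<forall>v\<in>V. 0 < l v" "sum l V = 1" "(\<Sum>v\<in>V. l v *\<^sub>R v) = 0"
    by (rule zero_combination)
  then have "0 \<in> rel_interior (convex hull V)"
    unfolding rel_interior_convex_hull_explicit[OF aff_indep] by blast
  then show ?thesis
    using affine_independent_span_eq[OF aff_indep card_V]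
    by (simp add: rel_interior_interior)
qed

text \<open>A linear relation on \<open>R\<close> becomes an affine one on \<open>V\<close> after
  subtracting a multiple of the positive combination of zero, and affine relations on
  \<open>V\<close> are trivial.\<close>

lemma independent_proper_subset:
  assumes "R \<subset> V"
  shows "independent R"
proof (rule independent_if_scalars_zero)
  show "finite R"
    using assms finite_V finite_subset by blast
  fix f x assume f: "(\<Sum>v\<in>R. f v *\<^sub>R v) = 0" and x: "x \<in> R"
  obtain l where l: "\<forall>v\<in>V. 0 < l v" "sum l V = 1" "(\<Sum>v\<in>V. l v *\<^sub>R v) = 0"
    by (rule zero_combination)
  \<comment> \<open>The multiple \<open>sum f R\<close> makes the coefficients add up to zero. At a
    vertex outside \<open>R\<close> only \<open>- sum f R * l v\<close> remains, which forces
    \<open>sum f R = 0\<close>.\<close>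
  define g where "g v = (if v \<in> R then f v else 0) - sum f R * l v" for v
  have VR: "V \<inter> R = R"
    using assms by blast
  have 1: "sum g V = 0"
    using l(2) VR finite_V by (simp add: g_def sum_subtractf sum.If_cases flip: sum_distrib_left)
  have "(\<Sum>v\<in>V. g v *\<^sub>R v) = (\<Sum>v\<in>V. (if v \<in> R then f v *\<^sub>R v else 0)) - sum f R *\<^sub>R (\<Sum>v\<in>V. l v *\<^sub>R v)"
    unfolding scaleR_sum_right sum_subtractf[symmetric]
    by (intro sum.cong) (auto simp: g_def algebra_simps)
  also have "\<dots> = 0"
    using l(3) f VR finite_V by (simp add: sum.If_cases)
  finally have "\<forall>v\<in>V. g v = 0"
    using 1 aff_indep affine_dependent_explicit_finite[OF finite_V] by blast
  moreover obtain w where "w \<in> V" "w \<notin> R"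
    using assms by blast
  ultimately have "sum f R * l w = 0" "f x = sum f R * l x"
    using x assms by (auto simp: g_def split: if_splits)
  then show "f x = 0"
    using l(1) \<open>w \<in> V\<close> by force
qed

section \<open>Positive combinations of vertices and their maximizers\<close>

lemma span_V_minus: "w \<in> V \<Longrightarrow> span (V - {w}) = UNIV"
  using card_ge_dim_independent[OF subset_UNIV independent_proper_subset, of "V - {w}"] card_V
  by (auto simp: finite_V)

text \<open>The cones over proper subsets of \<open>V\<close> cover the space: any coefficients of
  \<open>c\<close> can be shifted by a multiple of the combination of zero until they are
  nonnegative with one of them zero.\<close>

lemma cone_combination:
  obtains a R where "R \<subset> V" "\<forall>v\<in>R. 0 < a v" "c = (\<Sum>v\<in>R. a v *\<^sub>R v)"
proof -
  obtain w where w: "w \<in> V" using V_nonempty by blast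
  have "c \<in> span V"
    using span_V_minus[OF w] span_mono[of "V - {w}" V] by auto
  then obtain b where b: "c = (\<Sum>v\<in>V. b v *\<^sub>R v)"
    by (auto simp: span_finite[OF finite_V])
  obtain l where l: "\<forall>v\<in>V. 0 < l v" "(\<Sum>v\<in>V. l v *\<^sub>R v) = 0"
    by (rule zero_combination)
  \<comment> \<open>The largest multiple of \<open>l\<close> that can be subtracted from
    \<open>b\<close> without a negative coefficient; a vertex attaining the minimum drops out, so
    \<open>R\<close> is proper.\<close>
  define m where "m = Min ((\<lambda>v. b v / l v) ` V)"
  define a where "a v = b v - m * l v" for v
  define R where "R = {v \<in> V. 0 < a v}"
  have "m \<le> b v / l v" if "v \<in> V" for v
    using that finite_V by (simp add: m_def)
  then have a: "0 \<le> a v" if "v \<in> V" for v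
    using that l(1) by (simp add: a_def field_simps)
  have "m \<in> (\<lambda>v. b v / l v) ` V"
    unfolding m_def using finite_V V_nonempty by (intro Min_in) auto
  then obtain u where u: "u \<in> V" "m = b u / l u"
    by blast
  then have "a u = 0"
    using l(1) by (force simp: a_def)
  then have "u \<notin> R"
    by (simp add: R_def)
  then have "R \<subset> V"
    using u(1) by (auto simp: R_def)
  moreover have "c = (\<Sum>v\<in>R. a v *\<^sub>R v)"
  proof -
    have "c = (\<Sum>v\<in>V. b v *\<^sub>R v) - m *\<^sub>R (\<Sum>v\<in>V. l v *\<^sub>R v)"
      using b l(2) by simp
    also have "\<dots> = (\<Sum>v\<in>V. a v *\<^sub>R v)"
      by (simp add: a_def scaleR_sum_right algebra_simps sum_subtractf)
    also have "\<dots> = (\<Sum>v\<in>R. a v *\<^sub>R v)"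
      using a finite_V by (intro sum.mono_neutral_right) (force simp: R_def)+
    finally show ?thesis .
  qed
  moreover have "\<forall>v\<in>R. 0 < a v"
    by (simp add: R_def)
  ultimately show ?thesis
    by (intro that)
qed

text \<open>
  Subtracting the largest multiple of the center of \<open>R\<close> that keeps the coefficients nonnegative
  moves the functional into the cone of a proper subset; on every center of a subset of \<open>R\<close> the
  vertices outside \<open>R\<close> fall short.
\<close>

lemma cone_vertex_dominates:
  assumes "R \<subseteq> V" "R \<noteq> {}" "\<forall>v\<in>R. 0 < a v"
  shows "\<exists>i\<in>R. \<forall>s\<in>V - R. s \<bullet> (\<Sum>v\<in>R. a v *\<^sub>R v) < i \<bullet> (\<Sum>v\<in>R. a v *\<^sub>R v)"
proof -
  have "finite R"
    using assms(1) finite_V finite_subset by blast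
  then show ?thesis
    using assms
  proof (induction R arbitrary: a rule: finite_psubset_induct)
    case (psubset R)
    obtain b where b: "\<forall>v\<in>R. 0 < b v" "sum b R = 1"
      and max: "maximizers V (\<Sum>v\<in>R. b v *\<^sub>R v) = R"
      by (rule center[OF psubset.prems(1,2)])
    define p where "p = (\<Sum>v\<in>R. b v *\<^sub>R v)"
    define t where "t = Min ((\<lambda>v. a v / b v) ` R)"
    define a' where "a' v = a v - t * b v" for v
    define R' where "R' = {v \<in> R. 0 < a' v}"
    have "t \<le> a v / b v" if "v \<in> R" for v
      using that psubset.hyps by (simp add: t_def)
    then have a': "0 \<le> a' v" if "v \<in> R" for v
      using that b(1) by (simp add: a'_def field_simps)
    have "t \<in> (\<lambda>v. a v / b v) ` R"
      unfolding t_def using psubset.hyps psubset.prems by (intro Min_in) auto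
    then obtain r where r: "r \<in> R" "t = a r / b r"
      by blast
    then have "t > 0"
      using b(1) r psubset.prems(3) by simp
    have "a' r = 0"
      using r b(1) by (force simp: a'_def)
    then have "r \<notin> R'"
      by (simp add: R'_def)
    then have R': "R' \<subset> R"
      using r(1) by (auto simp: R'_def)
    have c: "(\<Sum>v\<in>R. a v *\<^sub>R v) = (\<Sum>v\<in>R'. a' v *\<^sub>R v) + t *\<^sub>R p"
    proof -
      have "(\<Sum>v\<in>R'. a' v *\<^sub>R v) = (\<Sum>v\<in>R. a' v *\<^sub>R v)"
        using a' psubset.hyps by (intro sum.mono_neutral_left) (force simp: R'_def)+
      then show ?thesis
        by (simp add: a'_def p_def scaleR_sum_right algebra_simps sum_subtractf)
    qed
    have less: "s \<bullet> p < i \<bullet> p" if "s \<in> V - R" "i \<in> R" for s i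
      using maximizers_less[of i V p s] max that by (simp add: p_def)
    show ?case
    proof (cases "R' = {}")
      case True
      then show ?thesis
        using c less r(1) \<open>t > 0\<close> by auto
    next
      case False
      have "R' \<subseteq> V" "\<forall>v\<in>R'. 0 < a' v"
        using R' psubset.prems(1) by (auto simp: R'_def)
      from psubset.IH[OF R' this(1) False this(2)] obtain i where i: "i \<in> R'"
        "\<And>s. s \<in> V - R' \<Longrightarrow> s \<bullet> (\<Sum>v\<in>R'. a' v *\<^sub>R v) < i \<bullet> (\<Sum>v\<in>R'. a' v *\<^sub>R v)"
        by blast
      \<comment> \<open>As \<open>R'\<close> lies in \<open>R\<close>, the vertex \<open>s\<close>
        is also outside \<open>R'\<close> and \<open>i\<close> is also in \<open>R\<close>. Thus
        both the induction hypothesis and the center \<open>p\<close> strictly favor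
        \<open>i\<close>.\<close>
      have "s \<bullet> (\<Sum>v\<in>R. a v *\<^sub>R v) < i \<bullet> (\<Sum>v\<in>R. a v *\<^sub>R v)" if "s \<in> V - R" for s
        using i(2)[of s] less[OF that, of i] i(1) R' that \<open>t > 0\<close>
        unfolding c inner_add_right inner_scaleR_right
        by (intro add_strict_mono mult_strict_left_mono) auto
      then show ?thesis
        using i(1) R' by blast
    qed
  qed
qed

text \<open>The necessity half of the compatibility condition: a vertex outside \<open>R\<close> is
  strictly beaten by a vertex of \<open>R\<close>.\<close>

lemma maximizers_cone_subset:
  assumes "R \<subseteq> V" "R \<noteq> {}" "\<forall>v\<in>R. 0 < a v"
  shows "maximizers V (\<Sum>v\<in>R. a v *\<^sub>R v) \<subseteq> R"
proof
  fix x assume x: "x \<in> maximizers V (\<Sum>v\<in>R. a v *\<^sub>R v)"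
  obtain i where i: "i \<in> R"
    "\<And>s. s \<in> V - R \<Longrightarrow> s \<bullet> (\<Sum>v\<in>R. a v *\<^sub>R v) < i \<bullet> (\<Sum>v\<in>R. a v *\<^sub>R v)"
    using cone_vertex_dominates[OF assms] by blast
  have "i \<bullet> (\<Sum>v\<in>R. a v *\<^sub>R v) \<le> x \<bullet> (\<Sum>v\<in>R. a v *\<^sub>R v)" "x \<in> V"
    using x i(1) assms(1) by (auto simp: maximizers_def)
  then show "x \<in> R"
    using i(2)[of x] by (meson DiffI leD)
qed

text \<open>The sufficiency half. In the sum of the centers of \<open>S\<close> and
  \<open>R\<close>, the second keeps every coefficient on \<open>R\<close> positive and is maximal
  on all of \<open>R\<close>, so the common maximizers are \<open>S\<close>.\<close>

lemma exists_common_functional: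
  assumes "S \<subseteq> R" "S \<noteq> {}" "R \<subseteq> V"
  obtains a where "\<forall>v\<in>R. 0 < a v" "maximizers V (\<Sum>v\<in>R. a v *\<^sub>R v) = S"
proof -
  have "S \<subseteq> V" "R \<noteq> {}"
    using assms by auto
  obtain b where b: "\<forall>v\<in>S. 0 < b v" "sum b S = 1"
    and maxS: "maximizers V (\<Sum>v\<in>S. b v *\<^sub>R v) = S"
    by (rule center[OF \<open>S \<subseteq> V\<close> \<open>S \<noteq> {}\<close>])
  obtain e where e: "\<forall>v\<in>R. 0 < e v" "sum e R = 1"
    and maxR: "maximizers V (\<Sum>v\<in>R. e v *\<^sub>R v) = R"
    by (rule center[OF \<open>R \<subseteq> V\<close> \<open>R \<noteq> {}\<close>])
  define a where "a v = (if v \<in> S then b v else 0) + e v" for v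
  have "finite R"
    using assms finite_V finite_subset by blast
  then have "(\<Sum>v\<in>S. b v *\<^sub>R v) = (\<Sum>v\<in>R. (if v \<in> S then b v else 0) *\<^sub>R v)"
    using assms(1) by (intro sum.mono_neutral_cong_left) auto
  then have "(\<Sum>v\<in>R. a v *\<^sub>R v) = (\<Sum>v\<in>S. b v *\<^sub>R v) + (\<Sum>v\<in>R. e v *\<^sub>R v)"
    by (simp add: a_def scaleR_add_left sum.distrib)
  then have max: "maximizers V (\<Sum>v\<in>R. a v *\<^sub>R v) = S"
    using maximizers_functional_add[of V "\<Sum>v\<in>S. b v *\<^sub>R v" "\<Sum>v\<in>R. e v *\<^sub>R v"] maxS maxR assms
    by auto
  have "\<forall>v\<in>R. 0 < a v"
    using b(1) e(1) by (auto simp: a_def add_pos_pos)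
  then show ?thesis
    using max by (rule that[of a])
qed

section \<open>Faces of the dual simplex\<close>

text \<open>For proper \<open>R\<close> this is the face of the dual polar to the face
  \<open>convex hull R\<close>; the empty \<open>R\<close> gives the whole dual.\<close>

definition tight :: "'a set \<Rightarrow> 'a set" where
  "tight R = {x. (\<forall>v\<in>V. x \<bullet> v \<le> 1) \<and> (\<forall>v\<in>R. x \<bullet> v = 1)}"

lemma dual_polytope_eq: "dual_polytope (convex hull V) = {x. \<forall>v\<in>V. x \<bullet> v \<le> 1}"
proof (intro equalityI subsetI)
  fix x assume "x \<in> dual_polytope (convex hull V)"
  then show "x \<in> {x. \<forall>v\<in>V. x \<bullet> v \<le> 1}"
    by (auto simp: dual_polytope_def hull_inc)
next
  fix x assume "x \<in> {x. \<forall>v\<in>V. x \<bullet> v \<le> 1}"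
  then have "\<forall>v\<in>V. v \<bullet> x \<le> 1"
    by (simp add: inner_commute)
  then show "x \<in> dual_polytope (convex hull V)"
    using convex_hull_inner_le[of V x 1] by (simp add: dual_polytope_def inner_commute[of x])
qed

lemma polytope_dual: "polytope (dual_polytope (convex hull V))"
proof -
  have "dual_polytope (convex hull V) = \<Inter> ((\<lambda>v. {x. v \<bullet> x \<le> 1}) ` V)"
    by (auto simp: dual_polytope_eq inner_commute)
  then have "polyhedron (dual_polytope (convex hull V))"
    using finite_V by (auto intro!: polyhedron_Inter polyhedron_halfspace_le)
  moreover have "bounded (dual_polytope (convex hull V))"
  proof -
    obtain e where e: "e > 0" "cball 0 e \<subseteq> convex hull V"
      using zero_in_convex_hull_interior mem_interior_cball by blast
    have "norm x \<le> 1 / e" if x: "x \<in> dual_polytope (convex hull V)" for x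
    proof (cases "x = 0")
      case False
      \<comment> \<open>Rescaling \<open>x\<close> to norm \<open>e\<close> puts it in the ball
        inside the simplex; pairing it with \<open>x\<close> gives \<open>e * norm x\<close>, which
        is therefore at most 1.\<close>
      have "(e / norm x) *\<^sub>R x \<in> convex hull V"
        using e False by (intro subsetD[OF e(2)]) simp
      then have "x \<bullet> ((e / norm x) *\<^sub>R x) \<le> 1"
        using x by (auto simp: dual_polytope_def)
      then show ?thesis
        using e(1) False by (simp add: field_simps dot_square_norm power2_eq_square)
    qed (use e in simp)
    then show ?thesis
      by (auto simp: bounded_iff)
  qed
  ultimately show ?thesis
    by (simp add: polytope_eq_bounded_polyhedron)
qed

text \<open>Values may be prescribed on the basis \<open>V - {w}\<close>: 1 on \<open>R\<close> and
  0 elsewhere. The positive combination of zero then forces a nonpositive value at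
  \<open>w\<close>.\<close>

lemma exists_tight_point:
  assumes "R \<subset> V"
  obtains x where "\<forall>v\<in>R. x \<bullet> v = 1" "\<forall>v\<in>V - R. x \<bullet> v < 1"
proof -
  obtain w where w: "w \<in> V" "w \<notin> R"
    using assms by blast
  obtain l where l: "\<forall>v\<in>V. 0 < l v" "sum l V = 1" "(\<Sum>v\<in>V. l v *\<^sub>R v) = 0"
    by (rule zero_combination)
  define f where "f v = (if v \<in> R then 1 else 0 :: real)" for v
  obtain g :: "'a \<Rightarrow> real" where g: "linear g" "\<forall>v\<in>V - {w}. g v = f v"
    using linear_independent_extend[OF independent_proper_subset[of "V - {w}"], of f] w by blast
  \<comment> \<open>The vector that represents the functional \<open>g\<close> as an inner
    product.\<close>
  define x where "x = adjoint g 1"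
  have x: "x \<bullet> v = g v" for v
    using adjoint_works[OF g(1), of v 1] by (simp add: x_def inner_commute)
  have "0 = x \<bullet> (\<Sum>v\<in>V. l v *\<^sub>R v)"
    using l(3) by simp
  also have "\<dots> = (\<Sum>v\<in>V. l v * (x \<bullet> v))"
    by (simp add: inner_sum_right)
  also have "\<dots> = l w * (x \<bullet> w) + (\<Sum>v\<in>V - {w}. l v * (x \<bullet> v))"
    using w finite_V by (simp add: sum.remove)
  finally have "l w * (x \<bullet> w) = - (\<Sum>v\<in>V - {w}. l v * (x \<bullet> v))"
    by simp
  also have "\<dots> \<le> 0"
    using l(1) g(2) by (auto simp: x f_def less_imp_le intro!: sum_nonneg)
  finally have "l w * (x \<bullet> w) \<le> 0" .
  moreover have "0 < l w"
    using l(1) w(1) by blast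
  ultimately have "x \<bullet> w \<le> 0"
    by (simp add: mult_le_0_iff)
  moreover have "x \<bullet> v = f v" if "v \<in> V" "v \<noteq> w" for v
    using that g(2) x by simp
  ultimately have "\<forall>v\<in>R. x \<bullet> v = 1" "\<forall>v\<in>V - R. x \<bullet> v < 1"
    using assms w by (force simp: f_def)+
  then show ?thesis
    by (rule that)
qed

lemma tight_nonempty: "R \<subset> V \<Longrightarrow> tight R \<noteq> {}"
proof -
  assume "R \<subset> V"
  then obtain x where "\<forall>v\<in>R. x \<bullet> v = 1" "\<forall>v\<in>V - R. x \<bullet> v < 1"
    by (rule exists_tight_point)
  then have "x \<in> tight R"
    by (auto simp: tight_def) (metis DiffI less_imp_le order_refl)
  then show ?thesis by blast
qed

text \<open>\<open>R\<close> is recovered as the set of vertices at which all of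
  \<open>tight R\<close> takes the value 1; a point strict off \<open>R\<close> excludes the
  others.\<close>

lemma tight_inject:
  assumes "R \<subset> V" "R' \<subset> V" "tight R = tight R'"
  shows "R = R'"
proof -
  have char: "R = {v \<in> V. \<forall>x\<in>tight R. x \<bullet> v = 1}" if "R \<subset> V" for R
  proof -
    obtain x where x: "\<forall>v\<in>R. x \<bullet> v = 1" "\<forall>v\<in>V - R. x \<bullet> v < 1"
      using \<open>R \<subset> V\<close> by (rule exists_tight_point)
    then have "x \<in> tight R"
      by (auto simp: tight_def) (metis DiffI less_imp_le order_refl)
    moreover have "x \<bullet> v \<noteq> 1" if "v \<in> V - R" for v
      using x(2) that by force
    ultimately have "{v \<in> V. \<forall>x\<in>tight R. x \<bullet> v = 1} \<subseteq> R"
      by blast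
    moreover have "R \<subseteq> {v \<in> V. \<forall>x\<in>tight R. x \<bullet> v = 1}"
      using \<open>R \<subset> V\<close> by (auto simp: tight_def)
    ultimately show ?thesis by simp
  qed
  show ?thesis
    by (subst char[OF assms(1)], subst char[OF assms(2)]) (simp only: assms(3))
qed

text \<open>On the dual each \<open>x \<bullet> v\<close> is at most 1, so \<open>sum a R\<close>
  bounds the functional. The weights are positive, so equality means tightness at every vertex of
  \<open>R\<close>, and it is attained because \<open>tight R\<close> is nonempty.\<close>

lemma maximizers_dual:
  assumes "R \<subset> V" "\<forall>v\<in>R. 0 < a v"
  shows "maximizers (dual_polytope (convex hull V)) (\<Sum>v\<in>R. a v *\<^sub>R v) = tight R"
proof -
  define c where "c = (\<Sum>v\<in>R. a v *\<^sub>R v)"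
  have finR: "finite R"
    using assms(1) finite_V finite_subset by blast
  have inner: "x \<bullet> c = (\<Sum>v\<in>R. a v * (x \<bullet> v))" for x
    by (simp add: c_def inner_sum_right)
  have le: "x \<bullet> c \<le> sum a R" if "\<forall>v\<in>V. x \<bullet> v \<le> 1" for x
    unfolding inner
  proof (rule sum_mono)
    fix v assume "v \<in> R"
    then show "a v * (x \<bullet> v) \<le> a v"
      using that assms by (intro mult_left_le) (auto simp: less_imp_le)
  qed
  have eq: "x \<bullet> c = sum a R \<longleftrightarrow> (\<forall>v\<in>R. x \<bullet> v = 1)" if x: "\<forall>v\<in>V. x \<bullet> v \<le> 1" for x
  proof
    assume "x \<bullet> c = sum a R"
    then have "(\<Sum>v\<in>R. a v * (1 - x \<bullet> v)) = 0"
      by (simp add: inner right_diff_distrib sum_subtractf)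
    moreover have "0 \<le> a v * (1 - x \<bullet> v)" if "v \<in> R" for v
      using that x assms by (intro mult_nonneg_nonneg) (auto simp: less_imp_le)
    ultimately have "\<forall>v\<in>R. a v * (1 - x \<bullet> v) = 0"
      using sum_nonneg_eq_0_iff[OF finR, of "\<lambda>v. a v * (1 - x \<bullet> v)"] by blast
    then show "\<forall>v\<in>R. x \<bullet> v = 1"
      using assms(2) by force
  qed (simp add: inner)
  obtain x0 where "x0 \<in> tight R"
    using tight_nonempty[OF assms(1)] by blast
  then have x0: "\<forall>v\<in>V. x0 \<bullet> v \<le> 1" "x0 \<bullet> c = sum a R"
    using eq by (auto simp: tight_def)
  show ?thesis
    unfolding c_def[symmetric]
  proof (intro equalityI subsetI)
    fix x assume "x \<in> maximizers (dual_polytope (convex hull V)) c"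
    then have "\<forall>v\<in>V. x \<bullet> v \<le> 1" "sum a R \<le> x \<bullet> c"
      using x0 by (auto simp: maximizers_def dual_polytope_eq)
    then show "x \<in> tight R"
      using le eq by (auto simp: tight_def intro: antisym)
  next
    fix x assume "x \<in> tight R"
    then have "\<forall>v\<in>V. x \<bullet> v \<le> 1" "x \<bullet> c = sum a R"
      using eq by (auto simp: tight_def)
    then show "x \<in> maximizers (dual_polytope (convex hull V)) c"
      using le by (simp add: maximizers_def dual_polytope_eq)
  qed
qed

text \<open>At a point strict off \<open>R\<close>, small moves orthogonal to \<open>R\<close> stay
  inside \<open>tight R\<close>. Its direction space is thus the orthogonal complement of the
  independent set \<open>R\<close>.\<close>

lemma aff_dim_tight:
  assumes "R \<subset> V"
  shows "aff_dim (tight R) = int DIM('a) - int (card R)"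
proof -
  obtain x where x: "\<forall>v\<in>R. x \<bullet> v = 1" "\<forall>v\<in>V - R. x \<bullet> v < 1"
    by (rule exists_tight_point[OF assms])
  define N where "N = {y. \<forall>z\<in>span R. orthogonal z y}"
  define T where "T = (\<lambda>y. y - x) ` tight R"
  have N: "y \<in> N \<longleftrightarrow> (\<forall>v\<in>R. y \<bullet> v = 0)" for y
    unfolding N_def mem_Collect_eq
    by (metis orthogonal_def orthogonal_to_span span_base orthogonal_commute)
  have "dim {y \<in> UNIV. \<forall>z\<in>span R. orthogonal z y} + dim (span R) = dim (UNIV :: 'a set)"
    by (intro dim_subspace_orthogonal_to_vectors) auto
  then have dimN: "dim N + card R = DIM('a)"
    using dim_eq_card_independent[OF independent_proper_subset[OF assms]]
    by (simp add: N_def dim_UNIV)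
  have "x \<in> tight R"
    using x by (force simp: tight_def)
  then have aff: "aff_dim (tight R) = int (dim T)"
    unfolding T_def by (intro aff_dim_eq_dim_subtract hull_inc)
  have "T \<subseteq> N"
    using x by (auto simp: T_def N tight_def inner_diff_left)
  moreover have "N \<subseteq> span T"
  proof
    fix y assume y: "y \<in> N"
    have "\<exists>e>0. \<forall>v\<in>V - R. e * (y \<bullet> v) \<le> 1 - x \<bullet> v"
    proof -
      have "finite (V - R)" using finite_V by blast
      \<comment> \<open>Each of the finitely many slacks \<open>1 - x \<bullet> v\<close> is
        positive, so one small step length serves all of them.\<close>
      then have "\<forall>\<^sub>F e in at_right 0. \<forall>v\<in>V - R. e * (y \<bullet> v) \<le> 1 - x \<bullet> v"
      proof (rule eventually_ball_finite, intro ballI)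
        fix v assume v: "v \<in> V - R"
        have "((\<lambda>e. e * (y \<bullet> v)) \<longlongrightarrow> 0 * (y \<bullet> v)) (at_right 0)"
          by (intro tendsto_intros)
        then have "\<forall>\<^sub>F e in at_right 0. e * (y \<bullet> v) < 1 - x \<bullet> v"
          using x(2) v by (intro order_tendstoD) auto
        then show "\<forall>\<^sub>F e in at_right 0. e * (y \<bullet> v) \<le> 1 - x \<bullet> v"
          by (rule eventually_mono) simp
      qed
      moreover have "\<forall>\<^sub>F e in at_right (0::real). e > 0"
        by (simp add: eventually_at_right_less)
      ultimately have "\<forall>\<^sub>F e in at_right 0. e > 0 \<and> (\<forall>v\<in>V - R. e * (y \<bullet> v) \<le> 1 - x \<bullet> v)"
        by eventually_elim simp
      then show ?thesis
        using eventually_happens'[OF trivial_limit_at_right_real] by blast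
    qed
    then obtain e where e: "e > 0" "\<forall>v\<in>V - R. e * (y \<bullet> v) \<le> 1 - x \<bullet> v"
      by blast
    have yR: "\<forall>v\<in>R. y \<bullet> v = 0"
      using y N by blast
    have "(x + e *\<^sub>R y) \<bullet> v \<le> 1" if "v \<in> V" for v
      using that e(2) x(1) yR by (cases "v \<in> R") (auto simp: inner_add_left algebra_simps)
    then have "x + e *\<^sub>R y \<in> tight R"
      using x(1) yR by (auto simp: tight_def inner_add_left)
    then have "e *\<^sub>R y \<in> T"
      unfolding T_def by (intro image_eqI[of _ _ "x + e *\<^sub>R y"]) simp
    then have "(1 / e) *\<^sub>R (e *\<^sub>R y) \<in> span T"
      by (intro span_mul span_base)
    then show "y \<in> span T"
      using e(1) by simp
  qed
  ultimately have "dim T = dim N"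
    using dim_subset[of T N] dim_subset[of N "span T"] by simp
  then show ?thesis
    using aff dimN by linarith
qed

section \<open>Faces of the sum of the simplex and its dual\<close>

abbreviation sum_polytope :: "'a set" where
  "sum_polytope \<equiv> convex hull V + dual_polytope (convex hull V)"

lemma polytope_sum_polytope: "polytope sum_polytope"
proof -
  obtain W where "finite W" "dual_polytope (convex hull V) = convex hull W"
    using polytope_dual by (auto simp: polytope_def)
  then show ?thesis
    using finite_V by (metis convex_hull_set_plus finite_set_plus polytope_def)
qed

text \<open>The dual contains 0, so the sum contains the full-dimensional simplex.\<close>

lemma aff_dim_sum_polytope: "aff_dim sum_polytope = int DIM('a)"
proof -
  have "0 \<in> dual_polytope (convex hull V)"
    by (simp add: dual_polytope_def)
  then have "convex hull V \<subseteq> sum_polytope"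
    by (metis add.right_neutral set_plus_intro subsetI)
  moreover have "aff_dim (convex hull V) = int DIM('a)"
    using aff_dim_affine_independent[OF aff_indep] card_V by (simp add: aff_dim_convex_hull)
  ultimately show ?thesis
    by (metis aff_dim_le_DIM aff_dim_subset order_antisym)
qed

definition sum_face :: "'a set \<times> 'a set \<Rightarrow> 'a set" where
  "sum_face = (\<lambda>(S, T). convex hull S + tight (V - T))"

text \<open>Disjointness puts \<open>S\<close> inside \<open>V - T\<close>, so
  \<open>x \<bullet> y = 1\<close> throughout the two summands and their direction spaces are
  orthogonal. The dimensions are \<open>card S - 1\<close> and \<open>card T - 1\<close>, the latter
  because \<open>card V\<close> exceeds the dimension of the space by one.\<close>

lemma aff_dim_sum_face:
  assumes "S \<subseteq> V" "T \<subseteq> V" "S \<inter> T = {}" "S \<noteq> {}" "T \<noteq> {}"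
  shows "aff_dim (sum_face (S, T)) = int (card S) + int (card T) - 2"
proof -
  have VT: "V - T \<subset> V"
    using assms by blast
  obtain s where s: "s \<in> S"
    using assms by blast
  obtain t where t: "t \<in> tight (V - T)"
    using tight_nonempty[OF VT] by blast
  have one: "x \<bullet> y = 1" if x: "x \<in> convex hull S" and y: "y \<in> tight (V - T)" for x y
  proof -
    have "convex hull S \<subseteq> {z. y \<bullet> z = 1}"
      using y assms by (intro hull_minimal convex_hyperplane) (auto simp: tight_def)
    then show ?thesis
      using x by (auto simp: inner_commute)
  qed
  have "aff_dim (convex hull S + tight (V - T)) = aff_dim (convex hull S) + aff_dim (tight (V - T))"
    using s t one by (intro aff_dim_set_plus_orthogonal[of s _ t])
      (auto simp: hull_inc inner_diff_left inner_diff_right)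
  also have "aff_dim (convex hull S) = int (card S) - 1"
    using aff_dim_affine_independent[OF aff_indep_subset[OF assms(1)]]
    by (simp add: aff_dim_convex_hull)
  also have "aff_dim (tight (V - T)) = int DIM('a) - (int (card V) - int (card T))"
    using aff_dim_tight[OF VT] assms(2) finite_V
    by (simp add: card_Diff_subset finite_subset card_mono of_nat_diff)
  finally show ?thesis
    using card_V by (simp add: sum_face_def)
qed

lemma maximizers_sum_polytope:
  assumes "R \<subset> V" "\<forall>v\<in>R. 0 < a v" and c: "c = (\<Sum>v\<in>R. a v *\<^sub>R v)"
  shows "maximizers (convex hull V) c = convex hull (maximizers V c)"
    "maximizers (dual_polytope (convex hull V)) c = tight R"
    "maximizers (convex hull V) c \<noteq> {}" "maximizers (dual_polytope (convex hull V)) c \<noteq> {}"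
    "maximizers sum_polytope c = convex hull (maximizers V c) + tight R"
proof -
  show 1: "maximizers (convex hull V) c = convex hull (maximizers V c)"
    by (rule maximizers_convex_hull[OF finite_V])
  show 2: "maximizers (dual_polytope (convex hull V)) c = tight R"
    unfolding c by (rule maximizers_dual[OF assms(1,2)])
  show 3: "maximizers (convex hull V) c \<noteq> {}"
    using 1 maximizers_nonempty[OF finite_V V_nonempty] by simp
  show 4: "maximizers (dual_polytope (convex hull V)) c \<noteq> {}"
    using 2 tight_nonempty[OF assms(1)] by simp
  show "maximizers sum_polytope c = convex hull (maximizers V c) + tight R"
    using maximizers_set_plus[OF 3 4] 1 2 by simp
qed

text \<open>One functional exposes both summands and their sum; this shows that
  \<open>sum_face\<close> yields faces and lets the summands be recovered from it.\<close>

lemma sum_face_functional: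
  assumes "(S, T) \<in> split_pairs V m"
  shows "\<exists>c. maximizers (convex hull V) c = convex hull S \<and>
    maximizers (dual_polytope (convex hull V)) c = tight (V - T) \<and>
    maximizers (convex hull V) c \<noteq> {} \<and> maximizers (dual_polytope (convex hull V)) c \<noteq> {} \<and>
    maximizers sum_polytope c = sum_face (S, T)"
proof -
  have ST: "S \<subseteq> V - T" "S \<noteq> {}" "V - T \<subset> V"
    using assms by (auto simp: split_pairs_def)
  obtain a where a: "\<forall>v\<in>V - T. 0 < a v" "maximizers V (\<Sum>v\<in>V - T. a v *\<^sub>R v) = S"
    by (rule exists_common_functional[OF ST(1,2) psubset_imp_subset[OF ST(3)]])
  note max = maximizers_sum_polytope[OF ST(3) a(1) refl, unfolded a(2)]
  show ?thesis
    unfolding sum_face_def prod.case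
    by (intro exI[of _ "\<Sum>v\<in>V - T. a v *\<^sub>R v"] conjI max)
qed

lemma inj_on_sum_face: "inj_on sum_face (split_pairs V m)"
proof (rule inj_onI, clarify)
  fix S T S' T'
  assume 1: "(S, T) \<in> split_pairs V m" and 2: "(S', T') \<in> split_pairs V m"
    and eq: "sum_face (S, T) = sum_face (S', T')"
  from sum_face_functional[OF 1] obtain c where c: "maximizers (convex hull V) c = convex hull S"
    "maximizers (dual_polytope (convex hull V)) c = tight (V - T)"
    "maximizers (convex hull V) c \<noteq> {}" "maximizers (dual_polytope (convex hull V)) c \<noteq> {}"
    by (elim exE conjE)
  from sum_face_functional[OF 2] obtain c' where c': "maximizers (convex hull V) c' = convex hull S'"
    "maximizers (dual_polytope (convex hull V)) c' = tight (V - T')"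
    "maximizers (convex hull V) c' \<noteq> {}" "maximizers (dual_polytope (convex hull V)) c' \<noteq> {}"
    by (elim exE conjE)
  have "maximizers (convex hull V) c + maximizers (dual_polytope (convex hull V)) c =
    maximizers (convex hull V) c' + maximizers (dual_polytope (convex hull V)) c'"
    using eq by (simp add: sum_face_def c(1,2) c'(1,2))
  note maximizers_set_plus_inject[OF this c(3,4) c'(3,4)]
  then have hulls: "convex hull S = convex hull S'" and tights: "tight (V - T) = tight (V - T')"
    using c(1,2) c'(1,2) by simp_all
  have ST: "S \<subseteq> V" "T \<subseteq> V" "T \<noteq> {}" "S' \<subseteq> V" "T' \<subseteq> V" "T' \<noteq> {}"
    using 1 2 by (auto simp: split_pairs_def)
  have "S = S'"
    by (rule convex_hull_inject[OF ST(1,4) hulls])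
  moreover have "V - T \<subset> V" "V - T' \<subset> V"
    using ST by auto
  then have "V - T = V - T'"
    using tights by (rule tight_inject)
  ultimately show "S = S' \<and> T = T'"
    using ST by blast
qed

text \<open>Every nonempty face is exposed by some \<open>c\<close>, and \<open>c\<close> lies in
  the cone of some proper \<open>R\<close>; the pair is then \<open>R\<close> with the vertices
  maximizing \<open>c\<close>.\<close>

lemma faces_sum_polytope:
  assumes "k < DIM('a)"
  shows "{F. F face_of sum_polytope \<and> aff_dim F = int k} = sum_face ` split_pairs V (k + 2)"
proof (intro equalityI subsetI)
  fix F assume "F \<in> sum_face ` split_pairs V (k + 2)"
  then obtain S T where ST: "(S, T) \<in> split_pairs V (k + 2)" "F = sum_face (S, T)"
    by auto
  from sum_face_functional[OF ST(1)] obtain c where "maximizers sum_polytope c = F"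
    unfolding ST(2) by (elim exE conjE)
  then have "F face_of sum_polytope"
    using maximizers_face_of polytope_imp_convex[OF polytope_sum_polytope] by blast
  moreover have "aff_dim F = int k"
    using aff_dim_sum_face[of S T] ST by (auto simp: split_pairs_def)
  ultimately show "F \<in> {F. F face_of sum_polytope \<and> aff_dim F = int k}"
    by blast
next
  fix F assume "F \<in> {F. F face_of sum_polytope \<and> aff_dim F = int k}"
  then have F: "F face_of sum_polytope" "aff_dim F = int k"
    by auto
  then have "F \<noteq> {}"
    by auto
  then obtain c where c: "F = maximizers sum_polytope c"
    by (rule face_of_polyhedron_eq_maximizers[OF polytope_imp_polyhedron[OF polytope_sum_polytope] F(1)])
  obtain a R where R: "R \<subset> V" "\<forall>v\<in>R. 0 < a v" "c = (\<Sum>v\<in>R. a v *\<^sub>R v)"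
    by (rule cone_combination)
  \<comment> \<open>An empty \<open>R\<close> means \<open>c = 0\<close>, which exposes the whole
    polytope, of dimension larger than \<open>k\<close>.\<close>
  have "R \<noteq> {}"
  proof
    assume "R = {}"
    then have "F = sum_polytope"
      using c R(3) by (simp add: maximizers_def)
    then show False
      using aff_dim_sum_polytope F(2) assms by simp
  qed
  define S where "S = maximizers V c"
  have S: "S \<subseteq> R" "S \<noteq> {}"
    using maximizers_cone_subset[of R a] R \<open>R \<noteq> {}\<close> maximizers_nonempty[OF finite_V V_nonempty]
    by (auto simp: S_def)
  have RR: "V - (V - R) = R"
    using R(1) by blast
  have FS: "F = sum_face (S, V - R)"
    using maximizers_sum_polytope(5)[OF R] c RR by (simp add: sum_face_def S_def)
  have sets: "S \<subseteq> V" "V - R \<subseteq> V" "S \<inter> (V - R) = {}" "S \<noteq> {}" "V - R \<noteq> {}"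
    using S R(1) by auto
  then have "int (card S) + int (card (V - R)) - 2 = int k"
    using aff_dim_sum_face[OF sets] FS F(2) by simp
  then have "(S, V - R) \<in> split_pairs V (k + 2)"
    using sets by (simp add: split_pairs_def)
  then show "F \<in> sum_face ` split_pairs V (k + 2)"
    using FS by blast
qed

lemma num_faces_sum_polytope:
  assumes "k < DIM('a)"
  shows "num_faces k sum_polytope = ((DIM('a) + 1) choose (k + 2)) * (2 ^ (k + 2) - 2)"
proof -
  have "num_faces k sum_polytope = card (split_pairs V (k + 2))"
    unfolding num_faces_def faces_sum_polytope[OF assms] by (rule card_image[OF inj_on_sum_face])
  then show ?thesis
    using card_split_pairs[OF finite_V, of "k + 2"] card_V by simp
qed

end

theorem theorem6:
  fixes \<Delta> :: "'a::euclidean_space set" and k :: nat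
  assumes "int DIM('a) simplex \<Delta>"
    and "perfectly_centered \<Delta>"
    and "k \<le> DIM('a) - 1"
  shows "num_faces k (\<Delta> + dual_polytope \<Delta>) = ((DIM('a) + 1) choose (k + 2)) * (2 ^ (k + 2) - 2)"
proof -
  obtain V where V: "\<not> affine_dependent V" "int (card V) = int DIM('a) + 1" "\<Delta> = convex hull V"
    using assms(1) by (auto simp: simplex_def)
  interpret centered_simplex V
    using V assms(2) by unfold_locales auto
  \<comment> \<open>Positivity of the dimension keeps the natural-number subtraction from
    truncating.\<close>
  have "k < DIM('a)"
    using assms(3) DIM_positive[where 'a = 'a] by linarith
  then show ?thesis
    using num_faces_sum_polytope V(3) by simp
qed

end
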